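(* Any axially symmetric surface with Neumann boundary cannot have $H<0$ everywhere. That is, let $0<a<b$ and let $\rho_0:[a,b]\to\mathbb{R}$ be a smooth positive function with $\rho_0'(a)=\rho_0'(b)=0$, and let $M_0\subset\mathbb{R}^3$ be the surface obtained by rotating the graph of $\rho_0$ around the $x_1$-axis. Then it is not the case that the mean curvature $H$ of $M_0$ is negative at every point of $M_0$.
   Context: The mean curvature $H$ is the sum of the principal curvatures taken with respect to the unit normal pointing away from the $x_1$-axis, with sign such that a round sphere with outward normal has positive mean curvature. Explicitly, for the surface of revolution generated by $\rho_0$, $H=k+p$ with $k=\frac{-\rho_0''}{(1+\rho_0'^2)^{3/2}}$ and $p=\frac{1}{\rho_0\sqrt{1+\rho_0'^2}}$. The condition $\rho_0'(a)=\rho_0'(b)=0$ expresses that the surface meets the planes $x_1=a$ and $x_1=b$ orthogonally (Neumann boundary). *)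

theory Defs
  imports "HOL-Analysis.Analysis"
begin

text \<open>Derivatives are taken within \<open>{a..b}\<close>, hence are one-sided at the end points.\<close>

definition smooth_on_interval :: "real \<Rightarrow> real \<Rightarrow> (real \<Rightarrow> real) \<Rightarrow> bool" where
  "smooth_on_interval a b f \<longleftrightarrow>
     (\<exists>D :: nat \<Rightarrow> real \<Rightarrow> real. D 0 = f \<and>
        (\<forall>n. \<forall>x\<in>{a..b}. (D n has_real_derivative D (Suc n) x) (at x within {a..b})))"

definition surface_of_revolution :: "real \<Rightarrow> real \<Rightarrow> (real \<Rightarrow> real) \<Rightarrow> (real ^ 3) set" where
  "surface_of_revolution a b \<rho> =
     {vector [x, \<rho> x * cos \<theta>, \<rho> x * sin \<theta>] | x \<theta>. x \<in> {a..b}}"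

text \<open>Curves start at \<open>p\<close> and only their one-sided velocity is used, so that the definition
  also covers boundary points; there the velocities fill a half plane, whence the span.\<close>

definition tangent_space :: "(real ^ 3) set \<Rightarrow> real ^ 3 \<Rightarrow> (real ^ 3) set" where
  "tangent_space M p =
     span {v. \<exists>\<gamma> :: real \<Rightarrow> real ^ 3. \<gamma> 0 = p \<and> (\<forall>t\<in>{0..1}. \<gamma> t \<in> M) \<and>
                (\<gamma> has_vector_derivative v) (at 0 within {0..1})}"

text \<open>The unit normal of \<open>M\<close> at \<open>p\<close> pointing away from the first coordinate axis: its inner
  product with the radial vector \<open>(0, p\<^sub>2, p\<^sub>3)\<close> is positive.\<close>

definition unit_normal :: "(real ^ 3) set \<Rightarrow> real ^ 3 \<Rightarrow> real ^ 3" where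
  "unit_normal M p =
     (THE n. norm n = 1 \<and> (\<forall>v\<in>tangent_space M p. n \<bullet> v = 0) \<and>
             n $ 2 * p $ 2 + n $ 3 * p $ 3 > 0)"

text \<open>The principal curvatures are the eigenvalues, with multiplicity, of the differential of the
  unit normal on the tangent plane. No minus sign is put in front of the differential, so that a
  sphere with outward normal has positive principal curvatures.\<close>

definition principal_curvatures :: "(real ^ 3) set \<Rightarrow> real ^ 3 \<Rightarrow> real \<Rightarrow> real \<Rightarrow> bool" where
  "principal_curvatures M p \<kappa>\<^sub>1 \<kappa>\<^sub>2 \<longleftrightarrow>
     (\<exists>L v\<^sub>1 v\<^sub>2. (unit_normal M has_derivative L) (at p within M) \<and>
        norm v\<^sub>1 = 1 \<and> norm v\<^sub>2 = 1 \<and> v\<^sub>1 \<bullet> v\<^sub>2 = 0 \<and> span {v\<^sub>1, v\<^sub>2} = tangent_space M p \<and>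
        L v\<^sub>1 = \<kappa>\<^sub>1 *\<^sub>R v\<^sub>1 \<and> L v\<^sub>2 = \<kappa>\<^sub>2 *\<^sub>R v\<^sub>2)"

definition mean_curvature :: "(real ^ 3) set \<Rightarrow> real ^ 3 \<Rightarrow> real" where
  "mean_curvature M p = (THE H. \<exists>\<kappa>\<^sub>1 \<kappa>\<^sub>2. principal_curvatures M p \<kappa>\<^sub>1 \<kappa>\<^sub>2 \<and> H = \<kappa>\<^sub>1 + \<kappa>\<^sub>2)"

text \<open>The remainder shows that for a surface of revolution the definition is not vacuous and evaluates
  to \<open>k + p\<close> with \<open>k = - \<rho>'' / (1 + \<rho>'\<^sup>2)\<^bsup>3/2\<^esup>\<close> and \<open>p = 1 / (\<rho> (1 + \<rho>'\<^sup>2)\<^bsup>1/2\<^esup>)\<close>.\<close>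

lemma has_vector_derivative_3:
  fixes \<gamma> :: "real \<Rightarrow> real ^ 3"
  shows "(\<gamma> has_vector_derivative v) (at t within S) \<longleftrightarrow>
    (\<forall>i. ((\<lambda>s. \<gamma> s $ i) has_real_derivative v $ i) (at t within S))"
  unfolding has_vector_derivative_def has_field_derivative_def
  by (subst has_derivative_componentwise_within)
     (auto simp: Basis_vec_def inner_axis mult.commute[of _ "v $ _"] fun_eq_iff)

lemma has_vector_derivative_vector3:
  fixes f g h :: "real \<Rightarrow> real"
  assumes "(f has_real_derivative f') (at t within S)"
    "(g has_real_derivative g') (at t within S)" "(h has_real_derivative h') (at t within S)"
  shows "((\<lambda>s. vector [f s, g s, h s] :: real^3) has_vector_derivative vector [f', g', h'])
     (at t within S)"
  using assms by (simp add: has_vector_derivative_3 forall_3)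

lemma vec3_eq: "(u :: real^3) = v \<longleftrightarrow> u$1 = v$1 \<and> u$2 = v$2 \<and> u$3 = v$3"
  by (simp add: vec_eq_iff forall_3)

lemma inner3: "(u :: real^3) \<bullet> v = u$1 * v$1 + u$2 * v$2 + u$3 * v$3"
  by (simp add: inner_vec_def sum_3)

lemma zero_one_nontriv: "at (0::real) within {0..1} \<noteq> bot"
  by (simp add: trivial_limit_within islimpt_Icc)

context
  fixes a b :: real and \<rho> \<rho>1 \<rho>2 :: "real \<Rightarrow> real"
  assumes ab: "a < b"
    and pos: "\<And>x. x \<in> {a..b} \<Longrightarrow> 0 < \<rho> x"
    and d1: "\<And>x. x \<in> {a..b} \<Longrightarrow> (\<rho> has_real_derivative \<rho>1 x) (at x within {a..b})"
    and d2: "\<And>x. x \<in> {a..b} \<Longrightarrow> (\<rho>1 has_real_derivative \<rho>2 x) (at x within {a..b})"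
begin

private abbreviation (input) "M \<equiv> surface_of_revolution a b \<rho>"
private abbreviation (input) "P x \<theta> \<equiv> (vector [x, \<rho> x * cos \<theta>, \<rho> x * sin \<theta>] :: real^3)"
private abbreviation (input) "W x \<equiv> sqrt (1 + (\<rho>1 x)^2)"
private abbreviation (input) "E x \<theta> \<equiv> (vector [1, \<rho>1 x * cos \<theta>, \<rho>1 x * sin \<theta>] :: real^3)"
private abbreviation (input) "F \<theta> \<equiv> (vector [0, - sin \<theta>, cos \<theta>] :: real^3)"
private abbreviation (input) "N x \<theta> \<equiv> (vector [- \<rho>1 x, cos \<theta>, sin \<theta>] :: real^3)"

private lemma W_pos: "W x > 0" 
  by (simp add: add_pos_nonneg)

private lemma meridian:
  assumes "x \<in> {a..b}"
  obtains s where "s \<noteq> 0" "\<And>t. t \<in> {0..1} \<Longrightarrow> x + t * s \<in> {a..b}"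
proof (cases "x < b")
  case True
  have "x + t * (b - x) \<in> {a..b}" if "t \<in> {0..1}" for t
  proof -
    have "t * (b - x) \<le> 1 * (b - x)" "0 \<le> t * (b - x)"
      using that True by (intro mult_right_mono mult_nonneg_nonneg; auto)+
    then show ?thesis using assms by auto
  qed
  then show ?thesis using True that[of "b - x"] by auto
next
  case False
  have "x + t * (a - x) \<in> {a..b}" if "t \<in> {0..1}" for t
  proof -
    have "t * (x - a) \<le> 1 * (x - a)" "0 \<le> t * (x - a)"
      using that assms by (intro mult_right_mono mult_nonneg_nonneg; auto)+
    then show ?thesis using assms by (auto simp: algebra_simps)
  qed
  then show ?thesis using False that[of "a - x"] assms ab by auto
qed

private lemma along:
  assumes x: "x \<in> {a..b}" and s: "\<And>t. t \<in> {0..1} \<Longrightarrow> x + t * s \<in> {a..b}"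
    and f: "(f has_real_derivative f') (at x within {a..b})"
  shows "((\<lambda>t. f (x + t * s)) has_real_derivative f' * s) (at 0 within {0..1})"
proof -
  have "(f has_real_derivative f') (at (x + 0 * s) within (\<lambda>t. x + t * s) ` {0..1})"
    using f by (simp, rule DERIV_subset) (use s in auto)
  moreover have "((\<lambda>t. x + t * s) has_real_derivative s) (at 0 within {0..1})"
    by (auto intro!: derivative_eq_intros)
  ultimately show ?thesis
    using DERIV_image_chain[of f f' "\<lambda>t. x + t * s" 0 "{0..1}" s] by (simp add: o_def)
qed

private lemma mem_M: "x \<in> {a..b} \<Longrightarrow> P x \<theta> \<in> M"
  unfolding surface_of_revolution_def by blast

private lemma curve1:
  assumes x: "x \<in> {a..b}" and s: "\<And>t. t \<in> {0..1} \<Longrightarrow> x + t * s \<in> {a..b}"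
  shows "((\<lambda>t. P (x + t * s) \<theta>) has_vector_derivative s *\<^sub>R E x \<theta>) (at 0 within {0..1})"
proof -
  have "s *\<^sub>R E x \<theta> = vector [s, \<rho>1 x * s * cos \<theta>, \<rho>1 x * s * sin \<theta>]"
    by (simp add: vec3_eq)
  then show ?thesis
    by (auto intro!: has_vector_derivative_vector3 derivative_eq_intros along[OF x s d1[OF x]])
qed

private lemma curve2:
  "((\<lambda>t. P x (\<theta> + t)) has_vector_derivative \<rho> x *\<^sub>R F \<theta>) (at 0 within {0..1})"
proof -
  have "\<rho> x *\<^sub>R F \<theta> = vector [0, - (\<rho> x * sin \<theta>), \<rho> x * cos \<theta>]"
    by (simp add: vec3_eq)
  then show ?thesis
    by (auto intro!: has_vector_derivative_vector3 derivative_eq_intros)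
qed

private lemma velocity_orth:
  assumes x: "x \<in> {a..b}" and g: "\<gamma> 0 = P x \<theta>" "\<forall>t\<in>{0..1}. \<gamma> t \<in> M"
    and v: "(\<gamma> has_vector_derivative v) (at 0 within {0..1})"
  shows "N x \<theta> \<bullet> v = 0"
proof -
  have c: "((\<lambda>s. \<gamma> s $ i) has_real_derivative v $ i) (at 0 within {0..1})" for i
    using v by (simp add: has_vector_derivative_3)
  have in_ab: "\<gamma> t $ 1 \<in> {a..b}" and eq: "(\<gamma> t $ 2)^2 + (\<gamma> t $ 3)^2 = (\<rho> (\<gamma> t $ 1))^2"
    if "t \<in> {0..1}" for t
  proof -
    from g(2) that obtain y \<phi> where "\<gamma> t = P y \<phi>" "y \<in> {a..b}"
      unfolding surface_of_revolution_def by blast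
    then show "\<gamma> t $ 1 \<in> {a..b}" "(\<gamma> t $ 2)^2 + (\<gamma> t $ 3)^2 = (\<rho> (\<gamma> t $ 1))^2"
      by (auto simp: power_mult_distrib simp flip: distrib_left)
  qed
  have "(\<rho> has_real_derivative \<rho>1 x) (at (\<gamma> 0 $ 1) within (\<lambda>t. \<gamma> t $ 1) ` {0..1})"
    using d1[OF x] g(1) by (simp, intro DERIV_subset[OF d1[OF x]]) (use in_ab in auto)
  from DERIV_image_chain[OF this c[of 1]]
  have r: "((\<lambda>t. \<rho> (\<gamma> t $ 1)) has_real_derivative \<rho>1 x * v $ 1) (at 0 within {0..1})"
    by (simp add: o_def)
  have "((\<lambda>t. (\<rho> (\<gamma> t $ 1))^2) has_real_derivative 2 * \<rho> x * (\<rho>1 x * v $ 1)) (at 0 within {0..1})"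
    using g(1) by (auto intro!: derivative_eq_intros r)
  moreover have "((\<lambda>t. (\<rho> (\<gamma> t $ 1))^2) has_real_derivative
      2 * (\<rho> x * cos \<theta>) * v $ 2 + 2 * (\<rho> x * sin \<theta>) * v $ 3) (at 0 within {0..1})"
  proof (rule has_field_derivative_transform_within[where d = 1])
    show "((\<lambda>t. (\<gamma> t $ 2)^2 + (\<gamma> t $ 3)^2) has_real_derivative
      2 * (\<rho> x * cos \<theta>) * v $ 2 + 2 * (\<rho> x * sin \<theta>) * v $ 3) (at 0 within {0..1})"
      using g(1) by (auto intro!: derivative_eq_intros c)
  qed (use eq in auto)
  ultimately have "2 * \<rho> x * (\<rho>1 x * v $ 1) =
      2 * (\<rho> x * cos \<theta>) * v $ 2 + 2 * (\<rho> x * sin \<theta>) * v $ 3"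
    using vector_derivative_unique_within[OF zero_one_nontriv]
    by (metis has_real_derivative_iff_has_vector_derivative)
  then have "\<rho> x * (N x \<theta> \<bullet> v) = 0" by (simp add: inner3 algebra_simps)
  then show ?thesis using pos[OF x] by simp
qed

private lemma decomp: "N x \<theta> \<bullet> v = 0 \<Longrightarrow> v = (v$1) *\<^sub>R E x \<theta> + (cos \<theta> * v$3 - sin \<theta> * v$2) *\<^sub>R F \<theta>"
proof -
  assume "N x \<theta> \<bullet> v = 0"
  then have 1: "cos \<theta> * v$2 + sin \<theta> * v$3 = \<rho>1 x * v$1" by (simp add: inner3)
  have 2: "(sin \<theta>)^2 + (cos \<theta>)^2 = 1" by simp
  have "v$2 = v$1 * (\<rho>1 x * cos \<theta>) - (cos \<theta> * v$3 - sin \<theta> * v$2) * sin \<theta>"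
    using 1 2 by algebra
  moreover have "v$3 = v$1 * (\<rho>1 x * sin \<theta>) + (cos \<theta> * v$3 - sin \<theta> * v$2) * cos \<theta>"
    using 1 2 by algebra
  ultimately show ?thesis by (simp add: vec3_eq)
qed

private lemma tangent_space_revolution:
  assumes x: "x \<in> {a..b}"
  shows "tangent_space M (P x \<theta>) = {v. N x \<theta> \<bullet> v = 0}"
proof
  have "subspace {v. N x \<theta> \<bullet> v = 0}" by (rule subspace_hyperplane)
  then show "tangent_space M (P x \<theta>) \<subseteq> {v. N x \<theta> \<bullet> v = 0}"
    unfolding tangent_space_def by (intro span_minimal) (use velocity_orth[OF x] in blast)+
  let ?V = "{v. \<exists>\<gamma>. \<gamma> 0 = P x \<theta> \<and> (\<forall>t\<in>{0..1}. \<gamma> t \<in> M) \<and>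
       (\<gamma> has_vector_derivative v) (at 0 within {0..1})}"
  obtain s where s: "s \<noteq> 0" "\<And>t. t \<in> {0..1} \<Longrightarrow> x + t * s \<in> {a..b}"
    using meridian[OF x] by blast
  have "s *\<^sub>R E x \<theta> \<in> ?V"
    by (intro CollectI exI[of _ "\<lambda>t. P (x + t * s) \<theta>"] conjI curve1[OF x s(2)] ballI mem_M s) auto
  then have "(1/s) *\<^sub>R (s *\<^sub>R E x \<theta>) \<in> span ?V" by (intro span_scale span_base)
  then have 1: "E x \<theta> \<in> span ?V" using s(1) by simp
  have "\<rho> x *\<^sub>R F \<theta> \<in> ?V"
    by (intro CollectI exI[of _ "\<lambda>t. P x (\<theta> + t)"] conjI curve2 ballI mem_M x) auto
  then have "(1/\<rho> x) *\<^sub>R (\<rho> x *\<^sub>R F \<theta>) \<in> span ?V" by (intro span_scale span_base)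
  then have 2: "F \<theta> \<in> span ?V" using pos[OF x] by simp
  show "{v. N x \<theta> \<bullet> v = 0} \<subseteq> tangent_space M (P x \<theta>)"
  proof safe
    fix v assume "N x \<theta> \<bullet> v = 0"
    from decomp[OF this] show "v \<in> tangent_space M (P x \<theta>)"
      unfolding tangent_space_def using 1 2
      by (metis (no_types, lifting) span_add span_scale)
  qed
qed

private lemma NN: "N x \<theta> \<bullet> N x \<theta> = 1 + (\<rho>1 x)^2"
proof -
  have "(sin \<theta>)^2 + (cos \<theta>)^2 = 1" by simp
  then show ?thesis by (simp add: inner3 power2_eq_square algebra_simps)
qed

private lemma NE: "N x \<theta> \<bullet> E x \<theta> = 0"
proof -
  have "(sin \<theta>)^2 + (cos \<theta>)^2 = 1" by simp
  then have "cos \<theta> * (\<rho>1 x * cos \<theta>) - \<rho>1 x + sin \<theta> * (\<rho>1 x * sin \<theta>) = 0" by algebra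
  then show ?thesis by (simp add: inner3)
qed

private lemma EE: "E x \<theta> \<bullet> E x \<theta> = 1 + (\<rho>1 x)^2"
proof -
  have "(sin \<theta>)^2 + (cos \<theta>)^2 = 1" by simp
  then have "\<rho>1 x * cos \<theta> * (\<rho>1 x * cos \<theta>) + \<rho>1 x * sin \<theta> * (\<rho>1 x * sin \<theta>) = (\<rho>1 x)^2" by algebra
  then show ?thesis by (simp add: inner3)
qed

private lemma normal_unique:
  assumes n: "norm n = 1" "\<And>v. N x \<theta> \<bullet> v = 0 \<Longrightarrow> n \<bullet> v = 0" "n$2 * cos \<theta> + n$3 * sin \<theta> > 0"
  shows "n = (1 / W x) *\<^sub>R N x \<theta>"
proof -
  define c where "c = n$2 * cos \<theta> + n$3 * sin \<theta>"
  have sc: "(sin \<theta>)^2 + (cos \<theta>)^2 = 1" by simp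
  have e: "n \<bullet> E x \<theta> = 0" "n \<bullet> F \<theta> = 0"
    using sc by (intro n(2); simp add: inner3; algebra)+
  have e1: "n$1 + n$2 * (\<rho>1 x * cos \<theta>) + n$3 * (\<rho>1 x * sin \<theta>) = 0" and e2: "n$3 * cos \<theta> = n$2 * sin \<theta>"
    using e by (simp_all add: inner3)
  have 1: "n = c *\<^sub>R N x \<theta>"
  proof -
    have "n$1 = - (c * \<rho>1 x)" using e1 unfolding c_def by algebra
    moreover have "n$2 = c * cos \<theta>" "n$3 = c * sin \<theta>" using e2 sc unfolding c_def by algebra+
    ultimately show ?thesis by (simp add: vec3_eq)
  qed
  have "n \<bullet> n = 1" using n(1) by (simp add: norm_eq_1)
  then have "c^2 * (1 + (\<rho>1 x)^2) = 1"
    by (subst (asm) (1 2) 1) (simp add: NN power2_eq_square)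
  then have "(c * W x)^2 = 1" by (simp add: power_mult_distrib)
  moreover have "c * W x > 0" using n(3) W_pos by (simp add: c_def)
  ultimately have "c * W x = 1" by (simp add: power2_eq_1_iff)
  then have "c = 1 / W x" using W_pos[of x] by (simp add: field_simps)
  then show ?thesis using 1 by simp
qed

private lemma N_norm: "norm ((1 / W x) *\<^sub>R N x \<theta>) = 1"
proof -
  have "norm (N x \<theta>) = W x" by (simp add: norm_eq_sqrt_inner NN)
  then show ?thesis using W_pos[of x] by simp
qed

private lemma unit_normal_revolution:
  assumes x: "x \<in> {a..b}"
  shows "unit_normal M (P x \<theta>) = (1 / W x) *\<^sub>R N x \<theta>"
  unfolding unit_normal_def tangent_space_revolution[OF x]
proof (rule the_equality)
  have r: "n $ 2 * P x \<theta> $ 2 + n $ 3 * P x \<theta> $ 3 = \<rho> x * (n $ 2 * cos \<theta> + n $ 3 * sin \<theta>)"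
    for n :: "real^3" by (simp add: algebra_simps)
  have N: "((1 / W x) *\<^sub>R N x \<theta>) $ 2 * cos \<theta> + ((1 / W x) *\<^sub>R N x \<theta>) $ 3 * sin \<theta> = 1 / W x"
    by (simp add: flip: power2_eq_square add_divide_distrib)
  show "norm ((1 / W x) *\<^sub>R N x \<theta>) = 1 \<and> (\<forall>v\<in>{v. N x \<theta> \<bullet> v = 0}. ((1 / W x) *\<^sub>R N x \<theta>) \<bullet> v = 0) \<and>
      0 < ((1 / W x) *\<^sub>R N x \<theta>) $ 2 * P x \<theta> $ 2 + ((1 / W x) *\<^sub>R N x \<theta>) $ 3 * P x \<theta> $ 3"
    unfolding r N using N_norm[of x \<theta>] W_pos[of x] pos[OF x] by (simp add: inner_scaleR_left)
  show "n = (1 / W x) *\<^sub>R N x \<theta>" if "norm n = 1 \<and> (\<forall>v\<in>{v. N x \<theta> \<bullet> v = 0}. n \<bullet> v = 0) \<and>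
      0 < n $ 2 * P x \<theta> $ 2 + n $ 3 * P x \<theta> $ 3" for n
    using that pos[OF x] unfolding r by (intro normal_unique) (auto simp: zero_less_mult_iff)
qed

private lemma unit_normal_differentiable:
  assumes x: "x \<in> {a..b}"
  shows "unit_normal M differentiable (at (P x \<theta>) within M)"
proof -
  define G where "G q = ((1 / W (q$1)) *\<^sub>R ((- \<rho>1 (q$1)) *\<^sub>R axis 1 1 +
     (q$2 / \<rho> (q$1)) *\<^sub>R axis 2 1 + (q$3 / \<rho> (q$1)) *\<^sub>R axis 3 1) :: real^3)" for q :: "real^3"
  have G: "unit_normal M q = G q" if "q \<in> M" for q
  proof -
    from that obtain y \<phi> where q: "q = P y \<phi>" "y \<in> {a..b}"
      unfolding surface_of_revolution_def by blast
    show ?thesis unfolding q(1) unit_normal_revolution[OF q(2)]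
      using pos[OF q(2)] by (auto simp: G_def vec3_eq axis_def)
  qed
  have pr: "(\<lambda>q :: real^3. q $ i) differentiable (at (P x \<theta>) within M)" for i
    by (simp add: bounded_linear_imp_differentiable bounded_linear_vec_nth)
  have sub: "(\<lambda>q :: real^3. q $ 1) ` M \<subseteq> {a..b}"
    unfolding surface_of_revolution_def by auto
  have comp: "(\<lambda>q :: real^3. f (q $ 1)) differentiable (at (P x \<theta>) within M)"
    if "(f has_real_derivative f') (at x within {a..b})" for f :: "real \<Rightarrow> real" and f'
  proof -
    have "f differentiable (at (P x \<theta> $ 1) within (\<lambda>q :: real^3. q $ 1) ` M)"
      using DERIV_subset[OF that sub] by (auto simp: real_differentiable_def)
    from differentiable_chain_within[OF pr this] show ?thesis by (simp add: o_def)
  qed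
  have W': "((\<lambda>x. 1 / W x) has_real_derivative - (\<rho>1 x * \<rho>2 x) / W x ^ 3) (at x within {a..b})"
    using W_pos[of x] 
    by (auto intro!: derivative_eq_intros d2[OF x] simp: field_simps power3_eq_cube power2_eq_square add_nonneg_eq_0_iff)
  have m: "(\<lambda>q :: real^3. - \<rho>1 (q $ 1)) differentiable (at (P x \<theta>) within M)"
    by (rule differentiable_minus[OF comp[OF d2[OF x]]])
  have r: "(\<lambda>q :: real^3. q $ i / \<rho> (q $ 1)) differentiable (at (P x \<theta>) within M)" for i
    by (rule differentiable_divide[OF pr comp[OF d1[OF x]]]) (use pos[OF x] in auto)
  have w: "(\<lambda>q :: real^3. 1 / W (q $ 1)) differentiable (at (P x \<theta>) within M)"
    by (rule comp[OF W'])
  have c: "(\<lambda>q. f q *\<^sub>R (axis i 1 :: real^3)) differentiable (at (P x \<theta>) within M)"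
    if "f differentiable (at (P x \<theta>) within M)" for f :: "real^3 \<Rightarrow> real" and i
    by (rule differentiable_scaleR[OF that differentiable_const])
  have "G differentiable (at (P x \<theta>) within M)"
    unfolding G_def
    by (rule differentiable_scaleR[OF w differentiable_add[OF differentiable_add[OF c[OF m] c[OF r]] c[OF r]]])
  then show ?thesis
    by (rule differentiable_transform_within[OF _ zero_less_one mem_M[OF x]]) (simp add: G)
qed

private lemma derivative_along:
  assumes L: "(unit_normal M has_derivative L) (at p within M)"
    and g: "\<gamma> 0 = p" "\<And>t. t \<in> {0..1} \<Longrightarrow> \<gamma> t \<in> M"
    and v: "(\<gamma> has_vector_derivative v) (at 0 within {0..1})"
    and n: "((\<lambda>t. unit_normal M (\<gamma> t)) has_vector_derivative w) (at 0 within {0..1})"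
  shows "L v = w"
proof -
  have "(unit_normal M has_derivative L) (at (\<gamma> 0) within \<gamma> ` {0..1})"
    unfolding g(1) by (rule has_derivative_subset[OF L]) (use g(2) in blast)
  from vector_derivative_diff_chain_within[OF v this]
  have "((\<lambda>t. unit_normal M (\<gamma> t)) has_vector_derivative L v) (at 0 within {0..1})"
    by (simp add: o_def)
  from vector_derivative_unique_within[OF zero_one_nontriv this n] show ?thesis .
qed

private lemma eigen:
  assumes x: "x \<in> {a..b}" and L: "(unit_normal M has_derivative L) (at (P x \<theta>) within M)"
  shows "L (E x \<theta>) = (- \<rho>2 x / W x ^ 3) *\<^sub>R E x \<theta>" "L (F \<theta>) = (1 / (\<rho> x * W x)) *\<^sub>R F \<theta>"
proof -
  interpret L: bounded_linear L using L by (rule has_derivative_bounded_linear)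
  obtain s where s: "s \<noteq> 0" "\<And>t. t \<in> {0..1} \<Longrightarrow> x + t * s \<in> {a..b}"
    using meridian[OF x] by blast
  have Wsq: "W x ^ 2 = 1 + (\<rho>1 x)^2" by simp
  have w0: "W x \<noteq> 0" using W_pos[of x] by simp
  have W': "((\<lambda>x. 1 / W x) has_real_derivative - (\<rho>1 x * \<rho>2 x) / W x ^ 3) (at x within {a..b})"
    using W_pos[of x] 
    by (auto intro!: derivative_eq_intros d2[OF x] simp: field_simps power3_eq_cube power2_eq_square add_nonneg_eq_0_iff)
  have R: "((\<lambda>x. 1 / W x * (- \<rho>1 x)) has_real_derivative - \<rho>2 x / W x ^ 3) (at x within {a..b})"
  proof -
    have "- (\<rho>1 x * \<rho>2 x) / W x ^ 3 * (- \<rho>1 x) + (- \<rho>2 x) * (1 / W x)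
       = ((\<rho>1 x)^2 * \<rho>2 x - W x ^ 2 * \<rho>2 x) / W x ^ 3"
      using w0 by (simp add: divide_simps) (simp add: power3_eq_cube power2_eq_square algebra_simps)
    also have "\<dots> = - \<rho>2 x / W x ^ 3" unfolding Wsq by (simp add: algebra_simps)
    finally show ?thesis
      using DERIV_mult[OF W' DERIV_minus[OF d2[OF x]]] by (simp only:)
  qed
  let ?n = "\<lambda>t. vector [1 / W (x + t * s) * (- \<rho>1 (x + t * s)),
        1 / W (x + t * s) * cos \<theta>, 1 / W (x + t * s) * sin \<theta>] :: real^3"
  have n1: "unit_normal M (P (x + t * s) \<theta>) = ?n t" if "t \<in> {0..1}" for t
    unfolding unit_normal_revolution[OF s(2)[OF that]] by (simp add: vec3_eq)
  have "(?n has_vector_derivative s *\<^sub>R (- \<rho>2 x / W x ^ 3) *\<^sub>R E x \<theta>) (at 0 within {0..1})"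
  proof -
    have e: "s *\<^sub>R (- \<rho>2 x / W x ^ 3) *\<^sub>R E x \<theta> = vector [- \<rho>2 x / W x ^ 3 * s,
       - (\<rho>1 x * \<rho>2 x) / W x ^ 3 * s * cos \<theta>, - (\<rho>1 x * \<rho>2 x) / W x ^ 3 * s * sin \<theta>]"
      by (simp add: vec3_eq)
    show ?thesis unfolding e
      by (intro has_vector_derivative_vector3 DERIV_cmult_right along[OF x s(2) R] along[OF x s(2) W'])
  qed
  then have "((\<lambda>t. unit_normal M (P (x + t * s) \<theta>)) has_vector_derivative
      s *\<^sub>R (- \<rho>2 x / W x ^ 3) *\<^sub>R E x \<theta>) (at 0 within {0..1})"
    by (rule has_vector_derivative_transform_within[where d = 1]) (auto simp: n1)
  from derivative_along[OF L _ _ curve1[OF x s(2)] this]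
  have "L (s *\<^sub>R E x \<theta>) = s *\<^sub>R (- \<rho>2 x / W x ^ 3) *\<^sub>R E x \<theta>"
    using mem_M s(2) by simp
  then have "s *\<^sub>R L (E x \<theta>) = s *\<^sub>R (- \<rho>2 x / W x ^ 3) *\<^sub>R E x \<theta>" by (simp only: L.scaleR)
  then show "L (E x \<theta>) = (- \<rho>2 x / W x ^ 3) *\<^sub>R E x \<theta>" using s(1) by (simp only: scaleR_cancel_left) simp
  have "((\<lambda>t. vector [1 / W x * (- \<rho>1 x), 1 / W x * cos (\<theta> + t), 1 / W x * sin (\<theta> + t)] :: real^3)
     has_vector_derivative vector [0, 1 / W x * (- sin \<theta>), 1 / W x * cos \<theta>]) (at 0 within {0..1})"
    by (intro has_vector_derivative_vector3 DERIV_cmult) (auto intro!: derivative_eq_intros)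
  also have "(\<lambda>t. vector [1 / W x * (- \<rho>1 x), 1 / W x * cos (\<theta> + t), 1 / W x * sin (\<theta> + t)] :: real^3)
     = (\<lambda>t. unit_normal M (P x (\<theta> + t)))"
    unfolding unit_normal_revolution[OF x] by (simp add: vec3_eq fun_eq_iff)
  also have "vector [0, 1 / W x * (- sin \<theta>), 1 / W x * cos \<theta>] = (1 / W x) *\<^sub>R F \<theta>"
    by (simp add: vec3_eq)
  finally have "L (\<rho> x *\<^sub>R F \<theta>) = (1 / W x) *\<^sub>R F \<theta>"
    using derivative_along[OF L _ _ curve2] mem_M[OF x] by simp
  then have "\<rho> x *\<^sub>R L (F \<theta>) = \<rho> x *\<^sub>R (1 / (\<rho> x * W x)) *\<^sub>R F \<theta>"
    using pos[OF x] by (simp add: L.scaleR)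
  then show "L (F \<theta>) = (1 / (\<rho> x * W x)) *\<^sub>R F \<theta>"
    using pos[OF x] by (simp only: scaleR_cancel_left) simp
qed

private lemma trace_two:
  fixes v1 v2 e1 e2 :: "real^3"
  assumes "linear L" "span {v1, v2} = span {e1, e2}"
    and v: "norm v1 = 1" "norm v2 = 1" "v1 \<bullet> v2 = 0"
    and e: "norm e1 = 1" "norm e2 = 1" "e1 \<bullet> e2 = 0"
    and Lv: "L v1 = c1 *\<^sub>R v1" "L v2 = c2 *\<^sub>R v2" and Le: "L e1 = k *\<^sub>R e1" "L e2 = p *\<^sub>R e2"
  shows "c1 + c2 = k + p"
proof -
  interpret linear L by fact
  have "v1 \<in> span {e1, e2}" "v2 \<in> span {e1, e2}"
    using assms(2) by (metis insertCI span_base)+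
  then obtain x1 y1 x2 y2 where xy: "v1 = x1 *\<^sub>R e1 + y1 *\<^sub>R e2" "v2 = x2 *\<^sub>R e1 + y2 *\<^sub>R e2"
    unfolding span_breakdown_eq span_empty by (auto simp: algebra_simps)
  have ee: "e1 \<bullet> e1 = 1" "e2 \<bullet> e2 = 1" "e1 \<bullet> e2 = 0" "e2 \<bullet> e1 = 0"
    using e by (auto simp: norm_eq_1 inner_commute)
  have o: "x1^2 + y1^2 = 1" "x2^2 + y2^2 = 1" "x1 * x2 + y1 * y2 = 0"
    using v by (auto simp: norm_eq_1 xy inner_add_left inner_add_right ee power2_eq_square mult.commute)
  have "x1^2 + x2^2 = 1" "y1^2 + y2^2 = 1" using o by algebra+
  moreover have "c1 = L v1 \<bullet> v1" "c2 = L v2 \<bullet> v2" using v Lv by (auto simp: norm_eq_1)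
  then have "c1 = k * x1^2 + p * y1^2" "c2 = k * x2^2 + p * y2^2"
    by (auto simp: xy add scale Le inner_add_left inner_add_right ee power2_eq_square)
  ultimately show ?thesis by algebra
qed

lemma mean_curvature_surface_of_revolution:
  assumes x: "x \<in> {a..b}"
  shows "mean_curvature M (P x \<theta>) =
    - \<rho>2 x / (1 + (\<rho>1 x)^2) powr (3/2) + 1 / (\<rho> x * sqrt (1 + (\<rho>1 x)^2))"
proof -
  let ?k = "- \<rho>2 x / W x ^ 3" and ?p = "1 / (\<rho> x * W x)"
  let ?e = "(1 / W x) *\<^sub>R E x \<theta>"
  have "norm (E x \<theta>) = W x" by (simp add: norm_eq_sqrt_inner EE)
  then have e: "norm ?e = 1" using W_pos[of x] by simp
  have f: "norm (F \<theta>) = 1"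
    by (simp add: norm_eq_1 inner3 flip: power2_eq_square)
  have ef: "?e \<bullet> F \<theta> = 0" by (simp add: inner3)
  have T: "tangent_space M (P x \<theta>) = span {?e, F \<theta>}"
    unfolding tangent_space_revolution[OF x]
  proof
    show "span {?e, F \<theta>} \<subseteq> {v. N x \<theta> \<bullet> v = 0}"
      by (intro span_minimal subspace_hyperplane) (auto simp: NE inner_scaleR_right, simp add: inner3)
    show "{v. N x \<theta> \<bullet> v = 0} \<subseteq> span {?e, F \<theta>}"
    proof safe
      fix v assume "N x \<theta> \<bullet> v = 0"
      from decomp[OF this]
      have v: "v = (v$1 * W x) *\<^sub>R ?e + (cos \<theta> * v$3 - sin \<theta> * v$2) *\<^sub>R F \<theta>"
        using W_pos[of x] by simp
      show "v \<in> span {?e, F \<theta>}"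
        by (subst v) (intro span_add span_scale span_base; simp)
    qed
  qed
  have eig: "L ?e = ?k *\<^sub>R ?e \<and> L (F \<theta>) = ?p *\<^sub>R F \<theta>"
    if "(unit_normal M has_derivative L) (at (P x \<theta>) within M)" for L
  proof -
    interpret L: bounded_linear L using that by (rule has_derivative_bounded_linear)
    show ?thesis using eigen[OF x that] by (simp only: L.scaleR) (simp add: mult.commute)
  qed
  have "mean_curvature M (P x \<theta>) = ?k + ?p"
    unfolding mean_curvature_def
  proof (rule the_equality)
    obtain L where "(unit_normal M has_derivative L) (at (P x \<theta>) within M)"
      using unit_normal_differentiable[OF x] by (auto simp: differentiable_def)
    with eig[OF this] e f ef T
    have "principal_curvatures M (P x \<theta>) ?k ?p"
      unfolding principal_curvatures_def by blast
    then show "\<exists>c1 c2. principal_curvatures M (P x \<theta>) c1 c2 \<and> ?k + ?p = c1 + c2" by blast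
  next
    fix H assume "\<exists>c1 c2. principal_curvatures M (P x \<theta>) c1 c2 \<and> H = c1 + c2"
    then obtain c1 c2 L v1 v2 where *: "(unit_normal M has_derivative L) (at (P x \<theta>) within M)"
      "norm v1 = 1" "norm v2 = 1" "v1 \<bullet> v2 = 0" "span {v1, v2} = tangent_space M (P x \<theta>)"
      "L v1 = c1 *\<^sub>R v1" "L v2 = c2 *\<^sub>R v2" "H = c1 + c2"
      unfolding principal_curvatures_def by blast
    have "linear L" using *(1) by (rule has_derivative_linear)
    from trace_two[OF this *(5)[unfolded T] *(2-4) e f ef *(6,7)
        eig[OF *(1), THEN conjunct1] eig[OF *(1), THEN conjunct2]]
    show "H = ?k + ?p" unfolding *(8) .
  qed
  moreover have "W x ^ 3 = (1 + (\<rho>1 x)^2) powr (3/2)"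
    using W_pos[of x] by (simp add: powr_half_sqrt[symmetric] powr_powr add_nonneg_nonneg
      flip: powr_numeral)
  ultimately show ?thesis by simp
qed

end

end

theory Submission
  imports Defs
begin

text \<open>
  Write \<open>\<rho>'\<close>, \<open>\<rho>''\<close> for the derivatives of the profile \<open>\<rho>\<^sub>0\<close>. The mean curvature is
  \<open>H = k + p\<close>, where the rotational curvature \<open>p = 1 / (\<rho>\<^sub>0 (1 + \<rho>'\<^sup>2)\<^bsup>1/2\<^esup>)\<close> is always positive,
  so \<open>H < 0\<close> would force the meridian curvature \<open>k\<close> to be negative, that is \<open>\<rho>'' > 0\<close>,
  everywhere. But the Neumann condition says that \<open>\<rho>'\<close> takes the same value \<open>0\<close> at both ends,
  so by the mean value theorem \<open>\<rho>''\<close> vanishes at some interior point, and there \<open>H = p > 0\<close>.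
\<close>

lemma equal_end_slopes_imp_positive_mean_curvature:
  fixes \<rho> \<rho>' \<rho>'' :: "real \<Rightarrow> real"
  assumes ab: "a < b"
    and pos: "\<And>x. x \<in> {a..b} \<Longrightarrow> 0 < \<rho> x"
    and d1: "\<And>x. x \<in> {a..b} \<Longrightarrow> (\<rho> has_real_derivative \<rho>' x) (at x within {a..b})"
    and d2: "\<And>x. x \<in> {a..b} \<Longrightarrow> (\<rho>' has_real_derivative \<rho>'' x) (at x within {a..b})"
    and ends: "\<rho>' a = \<rho>' b"
  shows "\<exists>p\<in>surface_of_revolution a b \<rho>. mean_curvature (surface_of_revolution a b \<rho>) p > 0"
proof -
  have "\<exists>z\<in>{a<..<b}. \<rho>' b - \<rho>' a = \<rho>'' z * (b - a)"
    using mvt_simple[OF ab, of \<rho>' "\<lambda>x h. \<rho>'' x * h"] d2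
    by (auto simp: has_field_derivative_def)
  then obtain z where "z \<in> {a<..<b}" and "\<rho>'' z * (b - a) = 0"
    using ends by auto
  then have z: "z \<in> {a..b}" and flat: "\<rho>'' z = 0"
    using ab by auto
  let ?p = "vector [z, \<rho> z * cos 0, \<rho> z * sin 0] :: real^3"
  have "mean_curvature (surface_of_revolution a b \<rho>) ?p = 1 / (\<rho> z * sqrt (1 + (\<rho>' z)\<^sup>2))"
    using mean_curvature_surface_of_revolution[OF ab pos d1 d2 z, where \<theta> = 0] flat by simp
  also have "\<dots> > 0"
    using pos[OF z] by (simp add: add_pos_nonneg)
  finally have "mean_curvature (surface_of_revolution a b \<rho>) ?p > 0" .
  moreover have "?p \<in> surface_of_revolution a b \<rho>"
    unfolding surface_of_revolution_def using z by blast
  ultimately show ?thesis by blast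
qed

theorem mainTheorem2:
  fixes a b :: real and \<rho>\<^sub>0 :: "real \<Rightarrow> real"
  assumes "0 < a" and "a < b"
    and "smooth_on_interval a b \<rho>\<^sub>0"
    and "\<forall>x\<in>{a..b}. 0 < \<rho>\<^sub>0 x"
    and "(\<rho>\<^sub>0 has_real_derivative 0) (at a within {a..b})"
    and "(\<rho>\<^sub>0 has_real_derivative 0) (at b within {a..b})"
  shows "\<not> (\<forall>p\<in>surface_of_revolution a b \<rho>\<^sub>0.
              mean_curvature (surface_of_revolution a b \<rho>\<^sub>0) p < 0)"
proof -
  obtain D where D0: "D 0 = \<rho>\<^sub>0"
    and D: "\<And>n x. x \<in> {a..b} \<Longrightarrow> (D n has_real_derivative D (Suc n) x) (at x within {a..b})"
    using assms(3) unfolding smooth_on_interval_def by blast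
  have d1: "(\<rho>\<^sub>0 has_real_derivative D 1 x) (at x within {a..b})" if "x \<in> {a..b}" for x
    using D[OF that, of 0] D0 by simp
  have d2: "(D 1 has_real_derivative D 2 x) (at x within {a..b})" if "x \<in> {a..b}" for x
    using D[OF that, of 1] by (simp add: numeral_2_eq_2)
  (* One-sided derivatives are unique as well, because the end points are limit points of the interval. *)
  have slope: "D 1 x = 0"
    if "x \<in> {a..b}" and "(\<rho>\<^sub>0 has_real_derivative 0) (at x within {a..b})" for x
  proof -
    have "at x within {a..b} \<noteq> bot"
      using that(1) \<open>a < b\<close> by (simp add: trivial_limit_within islimpt_Icc)
    then show ?thesis
      using d1[OF that(1)] that(2) vector_derivative_unique_within
      by (metis has_real_derivative_iff_has_vector_derivative)
  qed
  have "D 1 a = D 1 b"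
    using slope assms(2,5,6) by simp
  with assms(2,4) d1 d2 obtain p
    where "p \<in> surface_of_revolution a b \<rho>\<^sub>0" "mean_curvature (surface_of_revolution a b \<rho>\<^sub>0) p > 0"
    using equal_end_slopes_imp_positive_mean_curvature[of a b \<rho>\<^sub>0 "D 1" "D 2"] by blast
  then show ?thesis by force
qed

end
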